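(* Let $n\geq 1$ and let $\theta$ be a reflexive and transitive binary relation on $\{1,2,\ldots,n\}$. Let $R$ be a ring and let $C$ be a Noetherian subring of the centre $Z(R)$ such that $R$ is a PI-algebra over $C$. If $A\in M_{n}(\theta,R)$ and $A$ is invertible in $M_{n}(R)$, then $A^{-1}$ is in $M_{n}(\theta,R)$.
   Context: All rings are associative with identity (not necessarily commutative), and every subring contains the identity of the larger ring. $Z(R)$ is the centre of $R$ and $M_n(R)$ the ring of $n\times n$ matrices over $R$. For a reflexive and transitive relation $\theta$ on $\{1,\ldots,n\}$, the structural matrix ring is the subring $M_{n}(\theta,R)=\{[a_{i,j}]\in M_{n}(R)\mid a_{i,j}=0\text{ if }(i,j)\notin\theta\}$ of $M_n(R)$. $R$ is a PI-algebra over $C$ if it satisfies a polynomial identity $f=0$, where $f$ is a polynomial in noncommuting variables with coefficients in $C$, at least one of whose monomials of highest degree has coefficient $1$. *)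

theory Defs
  imports "HOL-Algebra.Ring_Divisibility" "HOL-Algebra.Subrings"
begin

definition ring_center :: "('a, 'b) ring_scheme \<Rightarrow> 'a set"
  where "ring_center R = {z \<in> carrier R. \<forall>x \<in> carrier R. z \<otimes>\<^bsub>R\<^esub> x = x \<otimes>\<^bsub>R\<^esub> z}"

text \<open>
  Matrices are extensional functions on the index square, so that equality in the
  carrier is equality of entries.
\<close>

definition matrix_ring :: "nat \<Rightarrow> ('a, 'b) ring_scheme \<Rightarrow> (nat \<times> nat \<Rightarrow> 'a) ring"
  where "matrix_ring n R =
    \<lparr>carrier = {1..n} \<times> {1..n} \<rightarrow>\<^sub>E carrier R,
     mult = (\<lambda>A B. \<lambda>(i, j) \<in> {1..n} \<times> {1..n}. \<Oplus>\<^bsub>R\<^esub>k \<in> {1..n}. A (i, k) \<otimes>\<^bsub>R\<^esub> B (k, j)),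
     one = (\<lambda>(i, j) \<in> {1..n} \<times> {1..n}. if i = j then \<one>\<^bsub>R\<^esub> else \<zero>\<^bsub>R\<^esub>),
     zero = (\<lambda>(i, j) \<in> {1..n} \<times> {1..n}. \<zero>\<^bsub>R\<^esub>),
     add = (\<lambda>A B. \<lambda>(i, j) \<in> {1..n} \<times> {1..n}. A (i, j) \<oplus>\<^bsub>R\<^esub> B (i, j))\<rparr>"

definition structural_matrix_ring ::
    "nat \<Rightarrow> (nat \<times> nat) set \<Rightarrow> ('a, 'b) ring_scheme \<Rightarrow> (nat \<times> nat \<Rightarrow> 'a) ring"
  where "structural_matrix_ring n \<theta> R = (matrix_ring n R)
    \<lparr>carrier := {A \<in> carrier (matrix_ring n R).
       \<forall>i \<in> {1..n}. \<forall>j \<in> {1..n}. (i, j) \<notin> \<theta> \<longrightarrow> A (i, j) = \<zero>\<^bsub>R\<^esub>}\<rparr>"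

text \<open>
  A polynomial in noncommuting variables \<open>x\<^sub>0, x\<^sub>1, \<dots>\<close> with coefficients in \<open>C\<close> is given by its
  coefficient function on words: \<open>[i, j, k]\<close> is the monomial \<open>x\<^sub>i x\<^sub>j x\<^sub>k\<close> and \<open>[]\<close> the
  constant one, so that the degree of a monomial is its length.
\<close>

definition nc_polynomials :: "('a, 'b) ring_scheme \<Rightarrow> 'a set \<Rightarrow> (nat list \<Rightarrow> 'a) set"
  where "nc_polynomials R C = {f \<in> UNIV \<rightarrow> C. finite {w. f w \<noteq> \<zero>\<^bsub>R\<^esub>}}"

definition nc_eval :: "('a, 'b) ring_scheme \<Rightarrow> (nat list \<Rightarrow> 'a) \<Rightarrow> (nat \<Rightarrow> 'a) \<Rightarrow> 'a"
  where "nc_eval R f \<sigma> =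
    (\<Oplus>\<^bsub>R\<^esub>w \<in> {w. f w \<noteq> \<zero>\<^bsub>R\<^esub>}. f w \<otimes>\<^bsub>R\<^esub> foldr (\<lambda>i p. \<sigma> i \<otimes>\<^bsub>R\<^esub> p) w \<one>\<^bsub>R\<^esub>)"

text \<open>
  A monomial with coefficient \<open>\<one>\<close> occurs in \<open>f\<close> as soon as \<open>\<one> \<noteq> \<zero>\<close>; in the zero ring the
  condition below holds trivially, so the zero ring counts as a PI-algebra.
\<close>

definition PI_algebra :: "('a, 'b) ring_scheme \<Rightarrow> 'a set \<Rightarrow> bool"
  where "PI_algebra R C \<longleftrightarrow> (\<exists>f \<in> nc_polynomials R C.
    (\<exists>w. f w = \<one>\<^bsub>R\<^esub> \<and> (\<forall>v. f v \<noteq> \<zero>\<^bsub>R\<^esub> \<longrightarrow> length v \<le> length w)) \<and>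
    (\<forall>\<sigma> \<in> UNIV \<rightarrow> carrier R. nc_eval R f \<sigma> = \<zero>\<^bsub>R\<^esub>))"

end

theory Submission
  imports Defs
begin

text \<open>
  The inverse of \<open>A\<close> can only leave the structural matrix ring if some one-sided inverse in the full
  matrix ring fails to be two-sided. Indeed, \<open>A\<close> is supported in \<open>\<theta>\<close> precisely if it preserves, for
  each \<open>j\<close>, the submodule of columns supported in \<open>{k. (k, j) \<in> \<theta>}\<close>. On such a submodule \<open>A\<close> has a
  left inverse, the corresponding corner of its inverse. If this is also a right inverse, then \<open>A\<close> maps
  the submodule onto itself, and the inverse of \<open>A\<close> preserves it too (\<open>inverse_preserves_corner\<close>,
  \<open>inverse_in_structural_matrix_ring\<close>). So the point is that \<open>y x = 1\<close> implies \<open>x y = 1\<close> for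
  matrices over a PI-algebra.

  The element \<open>1 - x y\<close> is idempotent, and the Jacobson radical contains no nonzero idempotent. Hence it
  suffices to show \<open>x y = 1\<close> modulo the annihilator of each simple left module \<open>V\<close>, and this is
  immediate if the ring has finite length modulo that annihilator, since a surjective endomorphism of
  a module of finite length is injective (\<open>defect_in_finitely_tested\<close>).

  For simple modules \<open>V\<close> over a PI-algebra the finite length is a weak form of Kaplansky's theorem: if
  the identity has degree \<open>d\<close>, then \<open>V\<close> has dimension at most \<open>d\<close> over its endomorphism ring. By
  density, more independent vectors would allow a monomial of degree \<open>d\<close> with coefficient \<open>1\<close> to act as
  a shift along them, while no other monomial of degree at most \<open>d\<close> reaches the end of the shift
  (\<open>PI_bounds_triangular\<close>). The finite length then passes from \<open>R\<close> to
  the matrices over \<open>R\<close> by Morita equivalence (\<open>finitely_tested_matrix_ring\<close>).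
\<close>

section \<open>Maximal left ideals\<close>

definition left_ideal :: "'a set \<Rightarrow> ('a, 'b) ring_scheme \<Rightarrow> bool"
  where "left_ideal I R \<longleftrightarrow> I \<subseteq> carrier R \<and> \<zero>\<^bsub>R\<^esub> \<in> I \<and>
    (\<forall>x \<in> I. \<forall>y \<in> I. x \<oplus>\<^bsub>R\<^esub> y \<in> I) \<and> (\<forall>a \<in> carrier R. \<forall>x \<in> I. a \<otimes>\<^bsub>R\<^esub> x \<in> I)"

definition maximal_left_ideal :: "'a set \<Rightarrow> ('a, 'b) ring_scheme \<Rightarrow> bool"
  where "maximal_left_ideal L R \<longleftrightarrow> left_ideal L R \<and> L \<noteq> carrier R \<and>
    (\<forall>I. left_ideal I R \<longrightarrow> L \<subseteq> I \<longrightarrow> I = L \<or> I = carrier R)"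

text \<open>
  Let \<open>V = R / L\<close>. The condition says that the annihilator of \<open>V\<close> is already the annihilator of
  finitely many elements of \<open>V\<close>. Then \<open>R / Ann(V)\<close> embeds, as a left module, in a finite power of
  \<open>V\<close>; for a maximal left ideal \<open>L\<close> it therefore has finite length. This is the only finiteness
  that the argument extracts from a polynomial identity.
\<close>

definition finitely_tested :: "'a set \<Rightarrow> ('a, 'b) ring_scheme \<Rightarrow> bool"
  where "finitely_tested L R \<longleftrightarrow> (\<exists>U. finite U \<and> U \<subseteq> carrier R \<and>
    (\<forall>r \<in> carrier R. (\<forall>u \<in> U. r \<otimes>\<^bsub>R\<^esub> u \<in> L) \<longrightarrow> (\<forall>x \<in> carrier R. r \<otimes>\<^bsub>R\<^esub> x \<in> L)))"

context ring
begin

lemma left_ideal_closed: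
  assumes "left_ideal I R"
  shows "x \<in> I \<Longrightarrow> x \<in> carrier R" and "\<zero> \<in> I"
    and "x \<in> I \<Longrightarrow> y \<in> I \<Longrightarrow> x \<oplus> y \<in> I"
    and "a \<in> carrier R \<Longrightarrow> x \<in> I \<Longrightarrow> a \<otimes> x \<in> I"
  using assms unfolding left_ideal_def by auto

lemma left_ideal_minus:
  assumes "left_ideal I R" "x \<in> I" "y \<in> I"
  shows "x \<ominus> y \<in> I"
proof -
  have xy: "x \<in> carrier R" "y \<in> carrier R"
    using assms left_ideal_closed(1) by blast+
  have "x \<ominus> y = x \<oplus> (\<ominus> \<one>) \<otimes> y"
    using xy by (simp add: minus_eq l_minus)
  with assms left_ideal_closed show ?thesis
    by (metis a_inv_closed one_closed)
qed

lemma left_ideal_diff_cancel: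
  assumes "left_ideal I R" "x \<ominus> y \<in> I" "y \<in> I" "x \<in> carrier R"
  shows "x \<in> I"
proof -
  have "y \<in> carrier R"
    using assms left_ideal_closed(1) by blast
  then have "x = (x \<ominus> y) \<oplus> y"
    using assms(4) by (simp add: minus_eq a_assoc l_neg)
  then show ?thesis
    using left_ideal_closed(3)[OF assms(1-3)] by simp
qed

lemma left_ideal_finsum:
  assumes "left_ideal I R" "\<And>k. k \<in> K \<Longrightarrow> g k \<in> I"
  shows "finsum R g K \<in> I"
  using assms(2)
proof (induction K rule: infinite_finite_induct)
  case (insert k K)
  then have "g \<in> K \<rightarrow> carrier R" "g k \<in> carrier R"
    using left_ideal_closed(1)[OF assms(1)] by blast+
  then show ?case
    using insert left_ideal_closed(3)[OF assms(1)] by simp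
qed (use left_ideal_closed(2)[OF assms(1)] in auto)

lemma left_ideal_one:
  assumes "left_ideal I R"
  shows "\<one> \<in> I \<longleftrightarrow> I = carrier R"
proof
  assume "\<one> \<in> I"
  then have "x \<in> I" if "x \<in> carrier R" for x
    using left_ideal_closed(4)[OF assms that, of \<one>] that by simp
  then show "I = carrier R"
    using left_ideal_closed(1)[OF assms] by blast
qed simp

text \<open>
  Zorn's lemma applies because properness of a left ideal is the single condition \<open>\<one> \<notin> I\<close>, which a
  union of a chain inherits.
\<close>

lemma proper_left_ideal_in_maximal:
  assumes I: "left_ideal I R" "\<one> \<notin> I"
  obtains L where "maximal_left_ideal L R" "I \<subseteq> L"
proof -
  define \<A> where "\<A> = {J. left_ideal J R \<and> \<one> \<notin> J \<and> I \<subseteq> J}"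
  have "\<exists>M \<in> \<A>. \<forall>X \<in> \<A>. M \<subseteq> X \<longrightarrow> X = M"
  proof (rule subset_Zorn_nonempty)
    show "\<A> \<noteq> {}"
      using I unfolding \<A>_def by blast
    show "\<Union>\<C> \<in> \<A>" if \<C>: "\<C> \<noteq> {}" "subset.chain \<A> \<C>" for \<C>
    proof -
      have sub: "\<C> \<subseteq> \<A>" and lin: "\<And>X Y. X \<in> \<C> \<Longrightarrow> Y \<in> \<C> \<Longrightarrow> X \<subseteq> Y \<or> Y \<subseteq> X"
        using \<C>(2) unfolding subset.chain_def by blast+
      have "x \<oplus> y \<in> \<Union>\<C>" if xy: "x \<in> \<Union>\<C>" "y \<in> \<Union>\<C>" for x y
      proof -
        obtain X Y where "X \<in> \<C>" "Y \<in> \<C>" "x \<in> X" "y \<in> Y"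
          using xy by blast
        then obtain Z where "Z \<in> \<C>" "x \<in> Z" "y \<in> Z"
          using lin by blast
        then show ?thesis
          using sub left_ideal_closed(3) unfolding \<A>_def by blast
      qed
      moreover have "a \<otimes> x \<in> \<Union>\<C>" if "a \<in> carrier R" "x \<in> \<Union>\<C>" for a x
        using that sub left_ideal_closed(4) unfolding \<A>_def by blast
      moreover have "\<Union>\<C> \<subseteq> carrier R"
        using sub left_ideal_closed(1) unfolding \<A>_def by blast
      moreover have "\<zero> \<in> \<Union>\<C>"
        using \<C>(1) sub left_ideal_closed(2) unfolding \<A>_def by blast
      ultimately have "left_ideal (\<Union>\<C>) R"
        unfolding left_ideal_def by simp
      moreover have "\<one> \<notin> \<Union>\<C>" "I \<subseteq> \<Union>\<C>"
        using \<C>(1) sub unfolding \<A>_def by auto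
      ultimately show ?thesis
        unfolding \<A>_def by simp
    qed
  qed
  then obtain L where L: "L \<in> \<A>" "\<And>X. X \<in> \<A> \<Longrightarrow> L \<subseteq> X \<Longrightarrow> X = L"
    by blast
  have "J = L \<or> J = carrier R" if "left_ideal J R" "L \<subseteq> J" for J
    using that L left_ideal_one[OF that(1)] unfolding \<A>_def by blast
  then have "maximal_left_ideal L R"
    using L(1) left_ideal_one unfolding \<A>_def maximal_left_ideal_def by blast
  then show thesis
    using that L(1) unfolding \<A>_def by blast
qed

lemma maximal_left_ideal_D:
  assumes "maximal_left_ideal L R"
  shows "left_ideal L R" and "\<one> \<notin> L"
  using assms left_ideal_one unfolding maximal_left_ideal_def by blast+

text \<open>
  In the simple module \<open>R / L\<close> every nonzero element generates everything. The elements \<open>y\<close> that are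
  congruent modulo \<open>L\<close> to a multiple of \<open>x\<close> form the left ideal generated by \<open>L\<close> and \<open>x\<close>.
\<close>

lemma maximal_left_ideal_generate:
  assumes L: "maximal_left_ideal L R" and x: "x \<in> carrier R" "x \<notin> L" and t: "t \<in> carrier R"
  obtains a where "a \<in> carrier R" "t \<ominus> a \<otimes> x \<in> L"
proof -
  note L' = maximal_left_ideal_D(1)[OF L]
  note cl = left_ideal_closed[OF L']
  define J where "J = {y \<in> carrier R. \<exists>a \<in> carrier R. y \<ominus> a \<otimes> x \<in> L}"
  have "left_ideal J R"
    unfolding left_ideal_def
  proof (intro conjI ballI)
    show "J \<subseteq> carrier R"
      unfolding J_def by blast
    have "\<zero> \<ominus> \<zero> \<otimes> x \<in> L"
      using cl(2) x(1) by (simp add: minus_eq)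
    then show "\<zero> \<in> J"
      unfolding J_def by blast
  next
    fix y z assume "y \<in> J" "z \<in> J"
    then obtain a b where ab: "y \<in> carrier R" "z \<in> carrier R" "a \<in> carrier R" "b \<in> carrier R"
      "y \<ominus> a \<otimes> x \<in> L" "z \<ominus> b \<otimes> x \<in> L"
      unfolding J_def by blast
    have "(y \<oplus> z) \<ominus> (a \<oplus> b) \<otimes> x = (y \<ominus> a \<otimes> x) \<oplus> (z \<ominus> b \<otimes> x)"
      using ab x(1) by (simp add: minus_eq l_distr minus_add a_ac)
    with ab cl(3) show "y \<oplus> z \<in> J"
      unfolding J_def by (metis (mono_tags, lifting) a_closed mem_Collect_eq)
  next
    fix c y assume c: "c \<in> carrier R" and "y \<in> J"
    then obtain a where a: "y \<in> carrier R" "a \<in> carrier R" "y \<ominus> a \<otimes> x \<in> L"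
      unfolding J_def by blast
    have "c \<otimes> y \<ominus> (c \<otimes> a) \<otimes> x = c \<otimes> (y \<ominus> a \<otimes> x)"
      using a c x(1) by (simp add: minus_eq r_distr r_minus m_assoc)
    with a c cl(4) show "c \<otimes> y \<in> J"
      unfolding J_def by (metis (mono_tags, lifting) m_closed mem_Collect_eq)
  qed
  moreover have "L \<subseteq> J"
  proof
    fix y assume y: "y \<in> L"
    then have "y \<ominus> \<zero> \<otimes> x = y"
      using cl(1) x(1) by (simp add: minus_eq)
    with y cl(1) show "y \<in> J"
      unfolding J_def by (metis (mono_tags, lifting) zero_closed mem_Collect_eq)
  qed
  moreover have "x \<in> J"
  proof -
    have "x \<ominus> \<one> \<otimes> x \<in> L"
      using x(1) cl(2) by (simp add: minus_eq r_neg)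
    then show ?thesis
      using x(1) unfolding J_def by blast
  qed
  ultimately have "J = carrier R"
    using L x(2) unfolding maximal_left_ideal_def by blast
  then show thesis
    using t that unfolding J_def by blast
qed

lemma maximal_left_idealI:
  assumes L: "left_ideal L R" "\<one> \<notin> L"
    and gen: "\<And>x. x \<in> carrier R \<Longrightarrow> x \<notin> L \<Longrightarrow> \<exists>a \<in> carrier R. \<one> \<ominus> a \<otimes> x \<in> L"
  shows "maximal_left_ideal L R"
proof -
  have "I = L \<or> I = carrier R" if I: "left_ideal I R" "L \<subseteq> I" for I
  proof (cases "I = L")
    case False
    then obtain x where x: "x \<in> I" "x \<notin> L"
      using I(2) by blast
    then obtain a where "a \<in> carrier R" "\<one> \<ominus> a \<otimes> x \<in> I"
      using gen I left_ideal_closed(1) by blast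
    then have "\<one> \<in> I"
      using left_ideal_diff_cancel[OF I(1)] left_ideal_closed(4)[OF I(1)] x(1) by blast
    then show ?thesis
      using left_ideal_one[OF I(1)] by blast
  qed simp
  then show ?thesis
    using L left_ideal_one[OF L(1)] unfolding maximal_left_ideal_def by blast
qed

section \<open>One-sided inverses\<close>

text \<open>
  The Jacobson radical contains no nonzero idempotent: the left annihilator of \<open>e\<close> contains
  \<open>\<one> \<ominus> e\<close>, so a maximal left ideal above it would contain both \<open>e\<close> and \<open>\<one> \<ominus> e\<close>.
\<close>

lemma idempotent_in_maximal_left_ideals_zero:
  assumes e: "e \<in> carrier R" "e \<otimes> e = e"
    and mem: "\<And>L. maximal_left_ideal L R \<Longrightarrow> e \<in> L"
  shows "e = \<zero>"
proof (rule ccontr)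
  assume ne: "e \<noteq> \<zero>"
  define I where "I = {a \<in> carrier R. a \<otimes> e = \<zero>}"
  have "left_ideal I R"
    unfolding left_ideal_def I_def using e(1) by (auto simp: l_distr m_assoc)
  moreover have "\<one> \<notin> I"
    using ne e(1) unfolding I_def by simp
  ultimately obtain L where L: "maximal_left_ideal L R" "I \<subseteq> L"
    by (rule proper_left_ideal_in_maximal)
  have "(\<one> \<ominus> e) \<otimes> e = \<zero>"
    using e by (simp add: minus_eq l_distr l_minus r_neg)
  then have "\<one> \<ominus> e \<in> L"
    using e(1) L(2) unfolding I_def by auto
  then have "\<one> \<in> L"
    using left_ideal_diff_cancel maximal_left_ideal_D(1)[OF L(1)] mem[OF L(1)] by blast
  then show False
    using maximal_left_ideal_D(2)[OF L(1)] by blast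
qed

text \<open>
  Let \<open>P\<close> be the annihilator of \<open>R / L\<close>. Right multiplication by \<open>x\<close> is a surjective endomorphism
  of the left module \<open>R / P\<close>, because \<open>y \<otimes> x = \<one>\<close>. As \<open>R / P\<close> has finite length, the kernels
  of its powers (below, \<open>N i\<close> is the preimage in \<open>R\<close> of the \<open>i\<close>-th one) become stationary. The
  element \<open>(\<one> \<ominus> x \<otimes> y) \<otimes> y [^] i\<close> is killed by the power \<open>i + 1\<close>, hence by the power \<open>i\<close>, which
  sends it to \<open>\<one> \<ominus> x \<otimes> y\<close>.

  Finite length is used in the following form. The testing elements \<open>us\<close> define a filtration
  \<open>F 0 \<supseteq> F 1 \<supseteq> \<dots> \<supseteq> F m\<close> from \<open>R\<close> down to \<open>P\<close>, whose factors embed in the simple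
  module \<open>R / L\<close>; \<open>T i\<close> records the factors that \<open>N i\<close> reaches. As \<open>N i \<subseteq> N (i + 1)\<close>, equality
  of the two records forces equality of the two submodules.
\<close>

lemma defect_in_finitely_tested:
  assumes L: "maximal_left_ideal L R" "finitely_tested L R"
    and xy: "x \<in> carrier R" "y \<in> carrier R" "y \<otimes> x = \<one>"
  shows "\<one> \<ominus> x \<otimes> y \<in> L"
proof -
  note L' = maximal_left_ideal_D(1)[OF L(1)]
  note cl = left_ideal_closed[OF L']
  obtain U where U: "finite U" "U \<subseteq> carrier R"
    and U_test: "\<forall>r \<in> carrier R. (\<forall>u \<in> U. r \<otimes> u \<in> L) \<longrightarrow> (\<forall>s \<in> carrier R. r \<otimes> s \<in> L)"
    using L(2) unfolding finitely_tested_def by auto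
  have test: "r \<otimes> s \<in> L"
    if "r \<in> carrier R" "\<And>u. u \<in> U \<Longrightarrow> r \<otimes> u \<in> L" "s \<in> carrier R" for r s
    using that U_test by auto
  obtain us where us: "set us = U"
    using finite_list[OF U(1)] by blast
  define m where "m = length us"
  have us_carrier: "us ! k \<in> carrier R" if "k < m" for k
    using that us U(2) unfolding m_def by auto
  define P where "P = {r \<in> carrier R. \<forall>s \<in> carrier R. r \<otimes> s \<in> L}"
  define N where "N i = {r \<in> carrier R. r \<otimes> x [^] i \<in> P}" for i :: nat
  define F where "F k = {r \<in> carrier R. \<forall>j < k. r \<otimes> us ! j \<in> L}" for k
  define T where "T i = {k. k < m \<and> (\<exists>z \<in> N i \<inter> F k. z \<otimes> us ! k \<notin> L)}" for i
  have pow: "x [^] i \<in> carrier R" "y [^] i \<in> carrier R" for i :: nat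
    using xy by auto
  have P_left: "left_ideal P R"
    unfolding left_ideal_def P_def using cl by (auto simp: l_distr m_assoc)
  have N_left: "left_ideal (N i) R" for i
    unfolding left_ideal_def N_def
    using left_ideal_closed[OF P_left] pow by (auto simp: l_distr m_assoc)
  have N_mono: "N i \<subseteq> N (Suc i)" for i
    unfolding N_def P_def using pow xy by (auto simp: m_assoc)
  have P_sub: "P \<subseteq> N i" for i
    unfolding N_def P_def using pow by (auto simp: m_assoc)
  have T_mono: "T i \<subseteq> T (Suc i)" for i
    using N_mono unfolding T_def by blast
  have T_card: "card (T i) \<le> m" for i
  proof -
    have "T i \<subseteq> {..<m}"
      unfolding T_def by blast
    then show ?thesis
      using card_mono[of "{..<m}" "T i"] by simp
  qed
  obtain i where i: "\<And>j. card (T j) \<le> card (T i)"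
    using ex_has_greatest_nat[of "\<lambda>_. True" 0 "\<lambda>j. card (T j)" "Suc m"] T_card by (auto simp: less_Suc_eq_le)
  have "finite (T (Suc i))"
    unfolding T_def by simp
  then have T_eq: "T i = T (Suc i)"
    using T_mono i by (meson card_seteq)
  \<comment> \<open>Downward along the filtration: modulo an element of \<open>N i\<close>, every element of
    \<open>N (Suc i) \<inter> F k\<close> can be moved into \<open>F (Suc k)\<close>.\<close>
  have step: "N (Suc i) \<inter> F k \<subseteq> N i" if "k \<le> m" for k
    using that
  proof (induction rule: inc_induct)
    case base
    have "F m \<subseteq> P"
    proof
      fix r assume r: "r \<in> F m"
      then have "r \<otimes> u \<in> L" if "u \<in> U" for u
        using that us unfolding F_def m_def by (auto simp: in_set_conv_nth)
      then show "r \<in> P"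
        using r test unfolding F_def P_def by auto
    qed
    then show ?case
      using P_sub by blast
  next
    case (step k)
    show ?case
    proof
      fix r assume r: "r \<in> N (Suc i) \<inter> F k"
      show "r \<in> N i"
      proof (cases "r \<otimes> us ! k \<in> L")
        case True
        with r have "r \<in> F (Suc k)"
          unfolding F_def by (auto simp: less_Suc_eq)
        then show ?thesis
          using r step by blast
      next
        case False
        then have "k \<in> T (Suc i)"
          using r step(2) unfolding T_def by blast
        then have "k \<in> T i"
          using T_eq by simp
        then obtain z where z: "z \<in> N i" "z \<in> F k" "z \<otimes> us ! k \<notin> L"
          unfolding T_def by blast
        have car: "r \<in> carrier R" "z \<in> carrier R" "us ! k \<in> carrier R"
          using r z us_carrier step(2) unfolding F_def by auto
        obtain a where a: "a \<in> carrier R" "r \<otimes> us ! k \<ominus> a \<otimes> (z \<otimes> us ! k) \<in> L"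
          using maximal_left_ideal_generate[OF L(1) _ z(3), of "r \<otimes> us ! k"] car by auto
        have az: "a \<otimes> z \<in> N i"
          using left_ideal_closed(4)[OF N_left a(1) z(1)] .
        have diff: "(r \<ominus> a \<otimes> z) \<otimes> u = r \<otimes> u \<ominus> a \<otimes> (z \<otimes> u)" if "u \<in> carrier R" for u
          using car a(1) that by (simp add: minus_eq l_distr l_minus m_assoc)
        have "(r \<ominus> a \<otimes> z) \<otimes> us ! j \<in> L" if "j < Suc k" for j
        proof (cases "j = k")
          case True
          then show ?thesis
            using a diff car by simp
        next
          case False
          then have "j < k" "j < m"
            using that step(2) by auto
          then have "r \<otimes> us ! j \<in> L" "a \<otimes> (z \<otimes> us ! j) \<in> L"
            using r z(2) cl(4)[OF a(1)] unfolding F_def by auto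
          then show ?thesis
            using diff us_carrier[OF \<open>j < m\<close>] left_ideal_minus[OF L'] by simp
        qed
        then have "r \<ominus> a \<otimes> z \<in> F (Suc k)"
          unfolding F_def using car a(1) by simp
        moreover have "r \<ominus> a \<otimes> z \<in> N (Suc i)"
          using left_ideal_minus[OF N_left] r az N_mono by blast
        ultimately have "r \<ominus> a \<otimes> z \<in> N i"
          using step by blast
        then show ?thesis
          using left_ideal_diff_cancel[OF N_left _ az car(1)] by blast
      qed
    qed
  qed
  have "F 0 = carrier R"
    unfolding F_def by simp
  then have N_eq: "N (Suc i) \<subseteq> N i"
    using step[of 0] left_ideal_closed(1)[OF N_left] by blast
  have yx: "y [^] i \<otimes> x [^] i = \<one>" for i :: nat
  proof (induction i)
    case (Suc i)
    have "y [^] Suc i \<otimes> x [^] Suc i = y [^] i \<otimes> y \<otimes> (x \<otimes> x [^] i)"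
      using xy(1) nat_pow_Suc2 by simp
    also have "\<dots> = y [^] i \<otimes> (y \<otimes> x) \<otimes> x [^] i"
      using xy(1,2) by (simp add: m_assoc)
    finally show ?case
      using Suc xy by simp
  qed simp
  define e where "e = \<one> \<ominus> x \<otimes> y"
  have e: "e \<in> carrier R"
    unfolding e_def using xy by simp
  have "x \<otimes> y \<otimes> x = x"
    using xy by (simp add: m_assoc)
  then have ex: "e \<otimes> x = \<zero>"
    unfolding e_def using xy by (simp add: minus_eq l_distr l_minus r_neg)
  define r where "r = e \<otimes> y [^] i"
  have r: "r \<in> carrier R" "r \<otimes> x [^] i = e"
    unfolding r_def using e pow yx by (simp_all add: m_assoc)
  then have "r \<otimes> x [^] Suc i = \<zero>"
    using ex xy(1) pow by (simp add: m_assoc[symmetric])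
  then have "r \<in> N (Suc i)"
    unfolding N_def using r(1) left_ideal_closed(2)[OF P_left] by simp
  then have "e \<in> P"
    using N_eq r unfolding N_def by auto
  then have "e \<otimes> \<one> \<in> L"
    unfolding P_def by blast
  then show ?thesis
    using e unfolding e_def by simp
qed

text \<open>
  The defect \<open>\<one> \<ominus> x \<otimes> y\<close> is idempotent and lies in every maximal left ideal.
\<close>

lemma left_inverse_imp_right_inverse:
  assumes tested: "\<And>L. maximal_left_ideal L R \<Longrightarrow> finitely_tested L R"
    and xy: "x \<in> carrier R" "y \<in> carrier R" "y \<otimes> x = \<one>"
  shows "x \<otimes> y = \<one>"
proof -
  have "x \<otimes> y \<otimes> (x \<otimes> y) = x \<otimes> (y \<otimes> x) \<otimes> y"
    using xy(1,2) by (simp add: m_assoc)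
  then have idem: "x \<otimes> y \<otimes> (x \<otimes> y) = x \<otimes> y"
    using xy by simp
  have "(\<one> \<ominus> x \<otimes> y) \<otimes> (\<one> \<ominus> x \<otimes> y) = \<one> \<ominus> x \<otimes> y"
    using xy(1,2) idem
    by (simp add: minus_eq l_distr r_distr l_minus r_minus a_assoc r_neg r_neg1 r_neg2 m_assoc)
  then have "\<one> \<ominus> x \<otimes> y = \<zero>"
    using idempotent_in_maximal_left_ideals_zero defect_in_finitely_tested[OF _ tested xy] xy(1,2)
    by (metis m_closed minus_closed one_closed)
  then show ?thesis
    using xy(1,2) by simp
qed

text \<open>
  Think of \<open>e\<close> as the projection to a submodule that \<open>a\<close> maps into itself. The restriction of \<open>a\<close> to
  this submodule has the left inverse \<open>e \<otimes> (inv a \<otimes> e)\<close>. If left inverses are also right inverses,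
  then \<open>a\<close> maps the submodule onto itself, so that \<open>inv a\<close> preserves it as well. Adding the
  complementary idempotent \<open>f\<close> turns the two restrictions into elements \<open>x\<close> and \<open>y\<close> of the whole
  ring with \<open>y \<otimes> x = \<one>\<close>.
\<close>

lemma inverse_preserves_corner:
  assumes direct: "\<And>x y. x \<in> carrier R \<Longrightarrow> y \<in> carrier R \<Longrightarrow> y \<otimes> x = \<one> \<Longrightarrow> x \<otimes> y = \<one>"
    and e: "e \<in> carrier R" "e \<otimes> e = e"
    and a: "a \<in> Units R" "e \<otimes> (a \<otimes> e) = a \<otimes> e"
  shows "e \<otimes> (inv a \<otimes> e) = inv a \<otimes> e"
proof -
  define b where "b = inv a"
  have ab: "a \<in> carrier R" "b \<in> carrier R" "b \<otimes> a = \<one>" "a \<otimes> b = \<one>"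
    unfolding b_def using a(1) by auto
  define f where "f = \<one> \<ominus> e"
  have f: "f \<in> carrier R" "f \<otimes> f = f" "e \<otimes> f = \<zero>" "f \<otimes> e = \<zero>"
    unfolding f_def using e by (simp_all add: minus_eq l_distr r_distr l_minus r_minus r_neg)
  have ef: "e \<oplus> f = \<one>"
    unfolding f_def using e a_lcomm[of e \<one> "\<ominus> e"] by (simp add: minus_eq r_neg)
  define x where "x = a \<otimes> e \<oplus> f"
  define y where "y = e \<otimes> (b \<otimes> e) \<oplus> f"
  have car: "x \<in> carrier R" "y \<in> carrier R"
    unfolding x_def y_def using ab e f by auto
  have fae: "f \<otimes> (a \<otimes> e) = \<zero>"
    using a(2) e ab f(1,4) by (metis l_null m_assoc m_closed)
  have ebae: "e \<otimes> (b \<otimes> e) \<otimes> (a \<otimes> e) = e"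
  proof -
    have "e \<otimes> (b \<otimes> e) \<otimes> (a \<otimes> e) = e \<otimes> (b \<otimes> (e \<otimes> (a \<otimes> e)))"
      using ab(1,2) e(1) by (simp add: m_assoc)
    also have "\<dots> = e \<otimes> (b \<otimes> a \<otimes> e)"
      using a(2) ab(1,2) e(1) by (simp add: m_assoc)
    finally show ?thesis
      using ab e by simp
  qed
  have ebf: "e \<otimes> (b \<otimes> e) \<otimes> f = \<zero>"
    using ab e f by (simp add: m_assoc)
  have "y \<otimes> x = \<one>"
    unfolding x_def y_def using ab(1,2) e(1) f ef ebae ebf fae by (simp add: l_distr r_distr)
  then have xy: "x \<otimes> y = \<one>"
    using direct car by blast
  have "x \<otimes> y \<otimes> e = x \<otimes> (e \<otimes> (b \<otimes> e))"
    unfolding y_def using car(1) ab(2) e f by (simp add: l_distr m_assoc)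
  also have "\<dots> = a \<otimes> (e \<otimes> e) \<otimes> (b \<otimes> e) \<oplus> f \<otimes> e \<otimes> (b \<otimes> e)"
    unfolding x_def using ab(1,2) e(1) f(1) by (simp add: l_distr m_assoc)
  also have "\<dots> = a \<otimes> (e \<otimes> (b \<otimes> e))"
    using ab(1,2) e f by (simp add: m_assoc)
  finally have "a \<otimes> (e \<otimes> (b \<otimes> e)) = x \<otimes> y \<otimes> e"
    by simp
  then have "a \<otimes> (e \<otimes> (b \<otimes> e)) = e"
    using xy e by simp
  then have "b \<otimes> (a \<otimes> (e \<otimes> (b \<otimes> e))) = b \<otimes> e"
    by simp
  then show ?thesis
    using ab e(1) unfolding b_def[symmetric] by (simp add: m_assoc[symmetric])
qed

end

section \<open>Simple modules over PI-algebras\<close>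

text \<open>
  Let \<open>V = R / L\<close> be simple and let \<open>D\<close> be the division ring of its endomorphisms. By Jacobson's
  density theorem an element of \<open>V\<close> lies outside the \<open>D\<close>-span of \<open>v 0, \<dots>, v (k - 1)\<close> exactly if
  some ring element annihilates these but not the given one. So this is linear independence of
  \<open>v 0, \<dots>, v (m - 1)\<close> over \<open>D\<close>, expressed without \<open>D\<close>.
\<close>

definition triangular :: "(nat \<Rightarrow> 'a) \<Rightarrow> nat \<Rightarrow> 'a set \<Rightarrow> ('a, 'b) ring_scheme \<Rightarrow> bool"
  where "triangular v m L R \<longleftrightarrow> (\<forall>k < m. v k \<in> carrier R \<and>
    (\<exists>r \<in> carrier R. (\<forall>j < k. r \<otimes>\<^bsub>R\<^esub> v j \<in> L) \<and> r \<otimes>\<^bsub>R\<^esub> v k \<notin> L))"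

context ring
begin

text \<open>
  The density theorem in triangular form: a ring element with the prescribed values on the earlier
  vectors is corrected by a multiple of one that annihilates them. The latter sends the new vector
  \<open>v m\<close> to a nonzero element of \<open>R / L\<close>, which generates the module.
\<close>

lemma triangular_density:
  assumes L: "maximal_left_ideal L R" and v: "triangular v m L R"
    and t: "\<And>j. j < m \<Longrightarrow> t j \<in> carrier R"
  shows "\<exists>r \<in> carrier R. \<forall>j < m. r \<otimes> v j \<ominus> t j \<in> L"
  using v t
proof (induction m)
  case (Suc m)
  note L' = maximal_left_ideal_D(1)[OF L]
  note cl = left_ideal_closed[OF L']
  have "triangular v m L R"
    using Suc.prems(1) unfolding triangular_def by simp
  then obtain r where r: "r \<in> carrier R" "\<And>j. j < m \<Longrightarrow> r \<otimes> v j \<ominus> t j \<in> L"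
    using Suc by (meson less_SucI)
  have v: "v j \<in> carrier R" if "j < Suc m" for j
    using Suc.prems(1) that unfolding triangular_def by blast
  obtain s where s: "s \<in> carrier R" "\<And>j. j < m \<Longrightarrow> s \<otimes> v j \<in> L" "s \<otimes> v m \<notin> L"
    using Suc.prems(1) unfolding triangular_def by blast
  obtain a where a: "a \<in> carrier R" "(t m \<ominus> r \<otimes> v m) \<ominus> a \<otimes> (s \<otimes> v m) \<in> L"
    using maximal_left_ideal_generate[OF L _ s(3), of "t m \<ominus> r \<otimes> v m"] v s(1) r(1) Suc.prems(2)
    by (metis lessI m_closed minus_closed)
  have as: "a \<otimes> s \<in> carrier R"
    using a s by simp
  have "(r \<oplus> a \<otimes> s) \<otimes> v j \<ominus> t j \<in> L" if "j < Suc m" for j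
  proof (cases "j = m")
    case True
    note car = v[of m] r(1) a(1) s(1) Suc.prems(2)[of m]
    have "(r \<oplus> a \<otimes> s) \<otimes> v m \<ominus> t m = (\<ominus> \<one>) \<otimes> ((t m \<ominus> r \<otimes> v m) \<ominus> a \<otimes> (s \<otimes> v m))"
      using car by (simp add: minus_eq l_distr m_assoc l_minus minus_add a_ac)
    also have "\<dots> \<in> L"
      using cl(4)[OF _ a(2)] by simp
    finally show ?thesis
      using True by simp
  next
    case False
    then have j: "j < m"
      using that by simp
    note car = v[OF that] r(1) a(1) s(1) Suc.prems(2)[OF that]
    have "(r \<oplus> a \<otimes> s) \<otimes> v j \<ominus> t j = (r \<otimes> v j \<ominus> t j) \<oplus> a \<otimes> (s \<otimes> v j)"
      using car by (simp add: minus_eq l_distr m_assoc a_ac)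
    then show ?thesis
      using cl(3)[OF r(2)[OF j] cl(4)[OF a(1) s(2)[OF j]]] by simp
  qed
  then show ?case
    using r(1) as by blast
qed auto

abbreviation word_value :: "(nat \<Rightarrow> 'a) \<Rightarrow> nat list \<Rightarrow> 'a"
  where "word_value \<sigma> u \<equiv> foldr (\<lambda>i p. \<sigma> i \<otimes> p) u \<one>"

lemma word_value_closed:
  assumes "\<And>i. \<sigma> i \<in> carrier R"
  shows "word_value \<sigma> u \<in> carrier R"
  using assms by (induction u) auto

text \<open>
  Let the generators act as shifts, where \<open>\<sigma> i\<close> moves \<open>v (j + 1)\<close> to \<open>v j\<close> when \<open>i\<close> is the letter of
  \<open>w\<close> at position \<open>j\<close> and kills it otherwise. A word \<open>u\<close> then acts on the last vector letter by letter
  from the right, and survives as long as it spells a suffix of \<open>w\<close>.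
\<close>

lemma word_value_shift:
  assumes L: "left_ideal L R"
    and \<sigma>: "\<And>i. \<sigma> i \<in> carrier R" and v: "\<And>j. j \<le> length w \<Longrightarrow> v j \<in> carrier R"
    and shift: "\<And>i j. j < length w \<Longrightarrow> \<sigma> i \<otimes> v (Suc j) \<ominus> (if w ! j = i then v j else \<zero>) \<in> L"
    and u: "length u \<le> length w"
  shows "word_value \<sigma> u \<otimes> v (length w) \<ominus>
    (if u = drop (length w - length u) w then v (length w - length u) else \<zero>) \<in> L"
  using u
proof (induction u)
  case Nil
  then show ?case
    using v[of "length w"] left_ideal_closed(2)[OF L] by (simp add: minus_eq r_neg)
next
  case (Cons i u)
  note cl = left_ideal_closed[OF L]
  define d where "d = length w"
  define j where "j = d - length (i # u)"
  have j: "j < length w" "d - length u = Suc j" "d - length (i # u) = j"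
    using Cons.prems unfolding j_def d_def by auto
  have vj: "v j \<in> carrier R" "v (Suc j) \<in> carrier R" "v d \<in> carrier R"
    using v j(1) unfolding d_def by auto
  define p where "p = word_value \<sigma> u"
  have p: "p \<in> carrier R"
    unfolding p_def using word_value_closed \<sigma> by blast
  have drop_j: "drop j w = w ! j # drop (Suc j) w"
    using j(1) by (simp add: Cons_nth_drop_Suc)
  have IH: "p \<otimes> v d \<ominus> (if u = drop (Suc j) w then v (Suc j) else \<zero>) \<in> L"
    using Cons.IH[OF Suc_leD[OF Cons.prems[unfolded list.size add_0_right add_Suc_right]]]
    unfolding p_def d_def j(2)[unfolded d_def] .
  have "\<sigma> i \<otimes> p \<otimes> v d \<ominus> (if i # u = drop j w then v j else \<zero>) \<in> L"
  proof (cases "u = drop (Suc j) w")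
    case True
    have "\<sigma> i \<otimes> (p \<otimes> v d \<ominus> v (Suc j)) \<oplus> (\<sigma> i \<otimes> v (Suc j) \<ominus> (if w ! j = i then v j else \<zero>)) \<in> L"
      using IH True cl(3,4) \<sigma> shift[OF j(1)] by simp
    moreover have "\<sigma> i \<otimes> (p \<otimes> v d \<ominus> v (Suc j)) \<oplus> (\<sigma> i \<otimes> v (Suc j) \<ominus> z) = \<sigma> i \<otimes> p \<otimes> v d \<ominus> z"
      if "z \<in> carrier R" for z
    proof -
      have "\<sigma> i \<otimes> (p \<otimes> v d \<ominus> v (Suc j)) \<oplus> (\<sigma> i \<otimes> v (Suc j) \<ominus> z)
        = \<sigma> i \<otimes> p \<otimes> v d \<oplus> (\<ominus> (\<sigma> i \<otimes> v (Suc j)) \<oplus> (\<sigma> i \<otimes> v (Suc j) \<oplus> \<ominus> z))"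
        using \<sigma>[of i] p vj that by (simp add: minus_eq r_distr r_minus m_assoc a_assoc)
      then show ?thesis
        using \<sigma>[of i] p vj that by (simp add: minus_eq r_neg1)
    qed
    ultimately show ?thesis
      using True vj(1) unfolding drop_j by (simp split: if_splits)
  next
    case False
    then have "\<sigma> i \<otimes> (p \<otimes> v d) \<in> L"
      using IH cl(4)[OF \<sigma>] p vj by (simp add: minus_eq)
    then show ?thesis
      using False \<sigma>[of i] p vj(3) unfolding drop_j by (simp add: minus_eq m_assoc)
  qed
  then show ?case
    unfolding p_def d_def j(3)[unfolded d_def] by simp
qed

text \<open>
  Kaplansky's bound. Let \<open>d\<close> be the length of \<open>w\<close>. If \<open>d + 1\<close> independent vectors existed, density
  would provide the shifts of the preceding lemma. Evaluated at these, the polynomial sends \<open>v d\<close> to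
  a combination of the vectors, with central coefficients. Among words of length at most \<open>d\<close> only \<open>w\<close>
  itself reaches \<open>v 0\<close>, and it does so with coefficient \<open>\<one>\<close>. An element \<open>s\<close> that maps \<open>v 0\<close> to \<open>\<one>\<close>
  and kills the other vectors modulo \<open>L\<close> detects this term, although the value of the polynomial
  is zero. Choosing the shifts according to \<open>w\<close> replaces the usual multilinearization of the
  identity.
\<close>

lemma PI_bounds_triangular:
  assumes L: "maximal_left_ideal L R"
    and f: "f \<in> nc_polynomials R C" and C: "C \<subseteq> ring_center R"
    and w: "f w = \<one>" "\<And>u. f u \<noteq> \<zero> \<Longrightarrow> length u \<le> length w"
    and identity: "\<And>\<sigma>. \<sigma> \<in> UNIV \<rightarrow> carrier R \<Longrightarrow> nc_eval R f \<sigma> = \<zero>"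
  shows "\<not> triangular v (Suc (length w)) L R"
proof
  assume tri: "triangular v (Suc (length w)) L R"
  note L' = maximal_left_ideal_D(1)[OF L]
  note cl = left_ideal_closed[OF L']
  define d where "d = length w"
  have v: "v j \<in> carrier R" if "j \<le> d" for j
    using tri that unfolding triangular_def d_def by auto
  have "\<exists>r \<in> carrier R. \<forall>j < Suc d. r \<otimes> v j \<ominus>
      (case j of 0 \<Rightarrow> \<zero> | Suc k \<Rightarrow> if w ! k = i then v k else \<zero>) \<in> L" for i
    using triangular_density[OF L tri, folded d_def] v by (simp split: nat.split)
  then obtain \<sigma> where \<sigma>: "\<And>i. \<sigma> i \<in> carrier R" and
    \<sigma>v: "\<And>i j. j < Suc d \<Longrightarrow> \<sigma> i \<otimes> v j \<ominus>
      (case j of 0 \<Rightarrow> \<zero> | Suc k \<Rightarrow> if w ! k = i then v k else \<zero>) \<in> L"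
    by metis
  obtain s where s: "s \<in> carrier R" and
    sv: "\<And>j. j < Suc d \<Longrightarrow> s \<otimes> v j \<ominus> (if j = 0 then \<one> else \<zero>) \<in> L"
    using triangular_density[OF L tri, folded d_def, of "\<lambda>j. if j = 0 then \<one> else \<zero>"]
    by (metis one_closed zero_closed)
  have p: "word_value \<sigma> u \<in> carrier R" for u
    using word_value_closed \<sigma> by blast
  define q where "q u = s \<otimes> (word_value \<sigma> u \<otimes> v d)" for u
  have q: "q u \<in> carrier R" for u
    unfolding q_def using s p v by simp
  have q_mod: "q u \<ominus> (if u = w then \<one> else \<zero>) \<in> L" if u: "length u \<le> d" for u
  proof -
    define k where "k = d - length u"
    define t where "t = (if u = drop k w then v k else \<zero>)"
    have k: "k \<le> d"
      unfolding k_def by simp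
    have uw: "u = w \<longleftrightarrow> k = 0" if "u = drop k w"
      using that u unfolding k_def d_def by (cases "length u = length w") auto
    have t: "t \<in> carrier R"
      unfolding t_def using v k by simp
    have "word_value \<sigma> u \<otimes> v d \<ominus> t \<in> L"
      unfolding t_def k_def d_def
    proof (rule word_value_shift[OF L' \<sigma>])
      show "\<sigma> i \<otimes> v (Suc j) \<ominus> (if w ! j = i then v j else \<zero>) \<in> L" if "j < length w" for i j
        using \<sigma>v[of "Suc j" i] that unfolding d_def by simp
    qed (use v u in \<open>simp_all add: d_def\<close>)
    then have 1: "s \<otimes> (word_value \<sigma> u \<otimes> v d \<ominus> t) \<in> L"
      using cl(4) s by blast
    have 2: "s \<otimes> t \<ominus> (if u = w then \<one> else \<zero>) \<in> L"
    proof (cases "u = drop k w")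
      case True
      then show ?thesis
        using sv[of k] k uw unfolding t_def by simp
    next
      case False
      then have "u \<noteq> w"
        unfolding k_def d_def by (metis diff_self_eq_0 drop0)
      with False show ?thesis
        unfolding t_def using s cl(2) by (simp add: minus_eq)
    qed
    have "s \<otimes> (word_value \<sigma> u \<otimes> v d \<ominus> t) \<oplus> (s \<otimes> t \<ominus> z) = q u \<ominus> z" if z: "z \<in> carrier R" for z
    proof -
      have "s \<otimes> (word_value \<sigma> u \<otimes> v d \<ominus> t) \<oplus> (s \<otimes> t \<ominus> z)
          = q u \<oplus> (\<ominus> (s \<otimes> t) \<oplus> (s \<otimes> t \<oplus> \<ominus> z))"
        unfolding q_def using s t z p[of u] v[of d] by (simp add: minus_eq r_distr r_minus a_assoc)
      then show ?thesis
        using s t z q by (simp add: minus_eq r_neg1)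
    qed
    then show ?thesis
      using cl(3)[OF 1 2] by auto
  qed
  define S where "S = {u. f u \<noteq> \<zero>}"
  have S: "finite S" "w \<in> S"
    using f w(1) maximal_left_ideal_D(2)[OF L] cl(2) unfolding S_def nc_polynomials_def by auto
  have central: "f u \<in> carrier R" "f u \<otimes> x = x \<otimes> f u" if "x \<in> carrier R" for u x
    using f C that unfolding nc_polynomials_def ring_center_def by auto
  have fu: "f u \<in> carrier R" for u
    using central(1)[OF one_closed] .
  have summand: "s \<otimes> (f u \<otimes> word_value \<sigma> u) \<otimes> v d = f u \<otimes> q u" for u
  proof -
    have "s \<otimes> (f u \<otimes> word_value \<sigma> u) \<otimes> v d = (s \<otimes> f u) \<otimes> (word_value \<sigma> u \<otimes> v d)"
      using s fu p v by (simp add: m_assoc)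
    also have "\<dots> = f u \<otimes> s \<otimes> (word_value \<sigma> u \<otimes> v d)"
      using central(2)[OF s] by simp
    also have "\<dots> = f u \<otimes> q u"
      unfolding q_def using s fu p v by (simp add: m_assoc)
    finally show ?thesis .
  qed
  have "(\<Oplus>u \<in> S. f u \<otimes> q u) = s \<otimes> nc_eval R f \<sigma> \<otimes> v d"
    unfolding nc_eval_def S_def[symmetric] summand[symmetric]
    using S s v fu p by (simp add: finsum_ldistr finsum_rdistr Pi_def)
  also have "\<dots> = \<zero>"
    using identity \<sigma> s v by simp
  finally have sum0: "(\<Oplus>u \<in> S. f u \<otimes> q u) = \<zero>" .
  have rest: "(\<Oplus>u \<in> S - {w}. f u \<otimes> q u) \<in> L"
  proof (rule left_ideal_finsum[OF L'])
    fix u assume "u \<in> S - {w}"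
    then have "q u \<ominus> \<zero> \<in> L"
      using q_mod[of u] w(2)[of u] unfolding S_def d_def by auto
    then show "f u \<otimes> q u \<in> L"
      using cl(4)[OF fu] q by (simp add: minus_eq)
  qed
  have "(\<Oplus>u \<in> S. f u \<otimes> q u) = f w \<otimes> q w \<oplus> (\<Oplus>u \<in> S - {w}. f u \<otimes> q u)"
    using finsum_insert[of "S - {w}" w "\<lambda>u. f u \<otimes> q u"] S fu q by (simp add: insert_absorb Pi_def)
  then have "q w \<oplus> (\<Oplus>u \<in> S - {w}. f u \<otimes> q u) = \<zero>"
    using sum0 w(1) q by simp
  then have "q w = \<ominus> (\<Oplus>u \<in> S - {w}. f u \<otimes> q u)"
    using minus_equality q cl(1)[OF rest] by metis
  then have "q w = (\<ominus> \<one>) \<otimes> (\<Oplus>u \<in> S - {w}. f u \<otimes> q u)"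
    using cl(1)[OF rest] by (simp add: l_minus)
  then have "q w \<in> L"
    using cl(4)[OF _ rest] by simp
  then have "q w \<ominus> (q w \<ominus> \<one>) \<in> L"
    using q_mod[of w] left_ideal_minus[OF L'] unfolding d_def by simp
  moreover have "q w \<ominus> (q w \<ominus> \<one>) = \<one>"
    using q[of w] by (simp add: minus_eq minus_add r_neg1 r_neg2)
  ultimately show False
    using maximal_left_ideal_D(2)[OF L] by simp
qed

text \<open>
  A longest independent sequence is a set of testing elements: an element that kills it but not some
  \<open>x\<close> would allow the sequence to be extended by \<open>x\<close>.
\<close>

lemma PI_finitely_tested:
  assumes PI: "PI_algebra R C" and C: "C \<subseteq> ring_center R" and L: "maximal_left_ideal L R"
  shows "finitely_tested L R"
proof -
  obtain f w where "f \<in> nc_polynomials R C" "f w = \<one>" "\<forall>u. f u \<noteq> \<zero> \<longrightarrow> length u \<le> length w"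
    "\<forall>\<sigma> \<in> UNIV \<rightarrow> carrier R. nc_eval R f \<sigma> = \<zero>"
    using PI unfolding PI_algebra_def by blast
  then have short: "\<not> triangular v (Suc (length w)) L R" for v
    using PI_bounds_triangular[OF L _ C] by blast
  have bound: "m < Suc (length w)" if "triangular v m L R" for v m
  proof (rule ccontr)
    assume "\<not> ?thesis"
    then have "triangular v (Suc (length w)) L R"
      using that unfolding triangular_def by auto
    then show False
      using short by blast
  qed
  have "\<exists>v. triangular v 0 L R"
    unfolding triangular_def by simp
  then obtain m where m: "\<exists>v. triangular v m L R" "\<And>k. \<exists>v. triangular v k L R \<Longrightarrow> k \<le> m"
    using ex_has_greatest_nat[of "\<lambda>m. \<exists>v. triangular v m L R" 0 "\<lambda>m. m" "Suc (length w)"] bound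
    by auto
  then obtain v where v: "triangular v m L R"
    by blast
  have "r \<otimes> x \<in> L" if r: "r \<in> carrier R" "\<forall>u \<in> v ` {..<m}. r \<otimes> u \<in> L" and x: "x \<in> carrier R" for r x
  proof (rule ccontr)
    assume "r \<otimes> x \<notin> L"
    then have "triangular (v(m := x)) (Suc m) L R"
      using v r x unfolding triangular_def by (auto simp: less_Suc_eq)
    then show False
      using m(2)[of "Suc m"] by auto
  qed
  moreover have "v ` {..<m} \<subseteq> carrier R"
    using v unfolding triangular_def by auto
  ultimately show ?thesis
    unfolding finitely_tested_def by (intro exI[of _ "v ` {..<m}"]) simp
qed

end

section \<open>Matrix rings\<close>

definition entry_matrix :: "nat \<Rightarrow> ('a, 'b) ring_scheme \<Rightarrow> nat \<Rightarrow> nat \<Rightarrow> 'a \<Rightarrow> nat \<times> nat \<Rightarrow> 'a"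
  where "entry_matrix n R i j r =
    (\<lambda>(a, b) \<in> {1..n} \<times> {1..n}. if a = i \<and> b = j then r else \<zero>\<^bsub>R\<^esub>)"

definition diagonal_matrix :: "nat \<Rightarrow> ('a, 'b) ring_scheme \<Rightarrow> (nat \<Rightarrow> 'a) \<Rightarrow> nat \<times> nat \<Rightarrow> 'a"
  where "diagonal_matrix n R d = (\<lambda>(a, b) \<in> {1..n} \<times> {1..n}. if a = b then d a else \<zero>\<^bsub>R\<^esub>)"

lemma matrix_eqI:
  assumes "A \<in> carrier (matrix_ring n R)" "B \<in> carrier (matrix_ring n R)"
    and "\<And>i j. i \<in> {1..n} \<Longrightarrow> j \<in> {1..n} \<Longrightarrow> A (i, j) = B (i, j)"
  shows "A = B"
proof (rule PiE_ext)
  show "A \<in> {1..n} \<times> {1..n} \<rightarrow>\<^sub>E carrier R" "B \<in> {1..n} \<times> {1..n} \<rightarrow>\<^sub>E carrier R"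
    using assms unfolding matrix_ring_def by simp_all
qed (use assms(3) in auto)

lemma matrix_entry_closed:
  assumes "A \<in> carrier (matrix_ring n R)" "i \<in> {1..n}" "j \<in> {1..n}"
  shows "A (i, j) \<in> carrier R"
  using assms unfolding matrix_ring_def by auto

lemma matrix_ring_entry:
  assumes "i \<in> {1..n}" "j \<in> {1..n}"
  shows "(A \<otimes>\<^bsub>matrix_ring n R\<^esub> B) (i, j) = (\<Oplus>\<^bsub>R\<^esub>k \<in> {1..n}. A (i, k) \<otimes>\<^bsub>R\<^esub> B (k, j))"
    and "(A \<oplus>\<^bsub>matrix_ring n R\<^esub> B) (i, j) = A (i, j) \<oplus>\<^bsub>R\<^esub> B (i, j)"
    and "\<zero>\<^bsub>matrix_ring n R\<^esub> (i, j) = \<zero>\<^bsub>R\<^esub>"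
    and "\<one>\<^bsub>matrix_ring n R\<^esub> (i, j) = (if i = j then \<one>\<^bsub>R\<^esub> else \<zero>\<^bsub>R\<^esub>)"
    and "entry_matrix n R k l r (i, j) = (if i = k \<and> j = l then r else \<zero>\<^bsub>R\<^esub>)"
    and "diagonal_matrix n R d (i, j) = (if i = j then d i else \<zero>\<^bsub>R\<^esub>)"
  using assms unfolding matrix_ring_def entry_matrix_def diagonal_matrix_def by simp_all

context ring
begin

lemma finsum_swap:
  assumes "finite S" "finite T" "\<And>s t. s \<in> S \<Longrightarrow> t \<in> T \<Longrightarrow> g s t \<in> carrier R"
  shows "(\<Oplus>s \<in> S. \<Oplus>t \<in> T. g s t) = (\<Oplus>t \<in> T. \<Oplus>s \<in> S. g s t)"
  using assms(1,3)
proof (induction S)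
  case (insert s S)
  have "(\<Oplus>s \<in> insert s S. \<Oplus>t \<in> T. g s t) = (\<Oplus>t \<in> T. g s t) \<oplus> (\<Oplus>t \<in> T. \<Oplus>s \<in> S. g s t)"
    using insert by (subst finsum_insert) (auto intro!: finsum_closed)
  also have "\<dots> = (\<Oplus>t \<in> T. g s t \<oplus> (\<Oplus>s \<in> S. g s t))"
    using insert by (intro finsum_addf[symmetric]) (auto intro!: finsum_closed)
  also have "\<dots> = (\<Oplus>t \<in> T. \<Oplus>s \<in> insert s S. g s t)"
    using insert by (intro finsum_cong') (auto intro!: finsum_closed simp: Pi_def)
  finally show ?case .
qed simp

lemma finsum_only:
  assumes "finite K" "k \<in> K" "h \<in> carrier R" "\<And>l. l \<in> K \<Longrightarrow> g l = (if l = k then h else \<zero>)"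
  shows "(\<Oplus>l \<in> K. g l) = h"
proof -
  have "(\<Oplus>l \<in> K. g l) = (\<Oplus>l \<in> K. if k = l then h else \<zero>)"
    using assms by (intro finsum_cong') auto
  also have "\<dots> = h"
    using finsum_singleton[of k K "\<lambda>_. h"] assms by simp
  finally show ?thesis .
qed

lemma matrix_carriers:
  shows "A \<in> carrier (matrix_ring n R) \<Longrightarrow> B \<in> carrier (matrix_ring n R) \<Longrightarrow>
      A \<otimes>\<^bsub>matrix_ring n R\<^esub> B \<in> carrier (matrix_ring n R)"
    and "A \<in> carrier (matrix_ring n R) \<Longrightarrow> B \<in> carrier (matrix_ring n R) \<Longrightarrow>
      A \<oplus>\<^bsub>matrix_ring n R\<^esub> B \<in> carrier (matrix_ring n R)"
    and "\<zero>\<^bsub>matrix_ring n R\<^esub> \<in> carrier (matrix_ring n R)"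
    and "\<one>\<^bsub>matrix_ring n R\<^esub> \<in> carrier (matrix_ring n R)"
    and "r \<in> carrier R \<Longrightarrow> entry_matrix n R i j r \<in> carrier (matrix_ring n R)"
    and "(\<And>i. d i \<in> carrier R) \<Longrightarrow> diagonal_matrix n R d \<in> carrier (matrix_ring n R)"
  unfolding matrix_ring_def entry_matrix_def diagonal_matrix_def
  by (auto intro!: finsum_closed split: if_splits)

lemma matrix_mult_assoc:
  assumes A: "A \<in> carrier (matrix_ring n R)" "B \<in> carrier (matrix_ring n R)"
    "D \<in> carrier (matrix_ring n R)"
  shows "A \<otimes>\<^bsub>matrix_ring n R\<^esub> B \<otimes>\<^bsub>matrix_ring n R\<^esub> D =
    A \<otimes>\<^bsub>matrix_ring n R\<^esub> (B \<otimes>\<^bsub>matrix_ring n R\<^esub> D)"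
proof (rule matrix_eqI[of _ n R])
  fix i j assume ij: "i \<in> {1..n}" "j \<in> {1..n}"
  note cl = matrix_entry_closed[OF A(1)] matrix_entry_closed[OF A(2)] matrix_entry_closed[OF A(3)]
  have "(\<Oplus>k \<in> {1..n}. (\<Oplus>l \<in> {1..n}. A (i, l) \<otimes> B (l, k)) \<otimes> D (k, j))
      = (\<Oplus>k \<in> {1..n}. \<Oplus>l \<in> {1..n}. A (i, l) \<otimes> (B (l, k) \<otimes> D (k, j)))"
    using cl ij by (intro finsum_cong')
      (auto simp: finsum_ldistr m_assoc Pi_def intro!: finsum_closed finsum_cong')
  also have "\<dots> = (\<Oplus>l \<in> {1..n}. \<Oplus>k \<in> {1..n}. A (i, l) \<otimes> (B (l, k) \<otimes> D (k, j)))"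
    using cl ij by (intro finsum_swap) auto
  also have "\<dots> = (\<Oplus>l \<in> {1..n}. A (i, l) \<otimes> (\<Oplus>k \<in> {1..n}. B (l, k) \<otimes> D (k, j)))"
    using cl ij by (intro finsum_cong') (auto simp: finsum_rdistr Pi_def intro!: finsum_closed)
  finally have sums: "(\<Oplus>k \<in> {1..n}. (\<Oplus>l \<in> {1..n}. A (i, l) \<otimes> B (l, k)) \<otimes> D (k, j))
      = (\<Oplus>l \<in> {1..n}. A (i, l) \<otimes> (\<Oplus>k \<in> {1..n}. B (l, k) \<otimes> D (k, j)))" .
  have "(A \<otimes>\<^bsub>matrix_ring n R\<^esub> B \<otimes>\<^bsub>matrix_ring n R\<^esub> D) (i, j)
      = (\<Oplus>k \<in> {1..n}. (\<Oplus>l \<in> {1..n}. A (i, l) \<otimes> B (l, k)) \<otimes> D (k, j))"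
    using cl ij by (simp only: matrix_ring_entry)
      (intro finsum_cong', auto simp: matrix_ring_entry intro!: finsum_closed)
  also note sums
  also have "(\<Oplus>l \<in> {1..n}. A (i, l) \<otimes> (\<Oplus>k \<in> {1..n}. B (l, k) \<otimes> D (k, j)))
      = (A \<otimes>\<^bsub>matrix_ring n R\<^esub> (B \<otimes>\<^bsub>matrix_ring n R\<^esub> D)) (i, j)"
    using cl ij by (simp only: matrix_ring_entry)
      (intro finsum_cong', auto simp: matrix_ring_entry matrix_carriers[THEN matrix_entry_closed] A
        intro!: finsum_closed)
  finally show "(A \<otimes>\<^bsub>matrix_ring n R\<^esub> B \<otimes>\<^bsub>matrix_ring n R\<^esub> D) (i, j) =
    (A \<otimes>\<^bsub>matrix_ring n R\<^esub> (B \<otimes>\<^bsub>matrix_ring n R\<^esub> D)) (i, j)" .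
qed (use A in \<open>simp_all add: matrix_carriers\<close>)

lemma matrix_mult_diagonal:
  assumes A: "A \<in> carrier (matrix_ring n R)" and d: "\<And>i. d i \<in> carrier R"
    and ij: "i \<in> {1..n}" "j \<in> {1..n}"
  shows "(diagonal_matrix n R d \<otimes>\<^bsub>matrix_ring n R\<^esub> A) (i, j) = d i \<otimes> A (i, j)"
    and "(A \<otimes>\<^bsub>matrix_ring n R\<^esub> diagonal_matrix n R d) (i, j) = A (i, j) \<otimes> d j"
proof -
  note cl = matrix_entry_closed[OF A]
  show "(diagonal_matrix n R d \<otimes>\<^bsub>matrix_ring n R\<^esub> A) (i, j) = d i \<otimes> A (i, j)"
    unfolding matrix_ring_entry(1)[OF ij] using cl d ij
    by (intro finsum_only[of _ i]) (auto simp: matrix_ring_entry)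
  show "(A \<otimes>\<^bsub>matrix_ring n R\<^esub> diagonal_matrix n R d) (i, j) = A (i, j) \<otimes> d j"
    unfolding matrix_ring_entry(1)[OF ij] using cl d ij
    by (intro finsum_only[of _ j]) (auto simp: matrix_ring_entry)
qed

lemma one_eq_diagonal: "\<one>\<^bsub>matrix_ring n R\<^esub> = diagonal_matrix n R (\<lambda>_. \<one>)"
  by (rule matrix_eqI[of _ n R]) (simp_all add: matrix_carriers matrix_ring_entry)

lemma ring_matrix_ring: "ring (matrix_ring n R)"
proof (rule ringI)
  show "abelian_group (matrix_ring n R)"
  proof (rule abelian_groupI)
    fix A assume A: "A \<in> carrier (matrix_ring n R)"
    define B where "B = (\<lambda>(i, j) \<in> {1..n} \<times> {1..n}. \<ominus> A (i, j))"
    have B: "B \<in> carrier (matrix_ring n R)"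
      using matrix_entry_closed[OF A] unfolding B_def by (auto simp: matrix_ring_def)
    have "B \<oplus>\<^bsub>matrix_ring n R\<^esub> A = \<zero>\<^bsub>matrix_ring n R\<^esub>"
      using A B matrix_entry_closed[OF A]
      by (intro matrix_eqI[of _ n R]) (auto simp: matrix_carriers matrix_ring_entry B_def l_neg)
    then show "\<exists>B \<in> carrier (matrix_ring n R). B \<oplus>\<^bsub>matrix_ring n R\<^esub> A = \<zero>\<^bsub>matrix_ring n R\<^esub>"
      using B by blast
  next
    fix A B D
    assume "A \<in> carrier (matrix_ring n R)" "B \<in> carrier (matrix_ring n R)"
      "D \<in> carrier (matrix_ring n R)"
    then show "A \<oplus>\<^bsub>matrix_ring n R\<^esub> B \<oplus>\<^bsub>matrix_ring n R\<^esub> D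
        = A \<oplus>\<^bsub>matrix_ring n R\<^esub> (B \<oplus>\<^bsub>matrix_ring n R\<^esub> D)"
      by (intro matrix_eqI[of _ n R])
        (simp_all add: matrix_carriers matrix_ring_entry(2) matrix_entry_closed a_assoc)
  next
    fix A B
    assume "A \<in> carrier (matrix_ring n R)" "B \<in> carrier (matrix_ring n R)"
    then show "A \<oplus>\<^bsub>matrix_ring n R\<^esub> B = B \<oplus>\<^bsub>matrix_ring n R\<^esub> A"
      by (intro matrix_eqI[of _ n R])
        (simp_all add: matrix_carriers matrix_ring_entry(2) matrix_entry_closed a_comm)
  next
    fix A
    assume "A \<in> carrier (matrix_ring n R)"
    then show "\<zero>\<^bsub>matrix_ring n R\<^esub> \<oplus>\<^bsub>matrix_ring n R\<^esub> A = A"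
      by (intro matrix_eqI[of _ n R])
        (simp_all add: matrix_carriers matrix_ring_entry(2,3) matrix_entry_closed)
  qed (simp_all add: matrix_carriers)
  show "monoid (matrix_ring n R)"
  proof (rule monoidI)
    fix A assume A: "A \<in> carrier (matrix_ring n R)"
    show "\<one>\<^bsub>matrix_ring n R\<^esub> \<otimes>\<^bsub>matrix_ring n R\<^esub> A = A"
      unfolding one_eq_diagonal using A
      by (intro matrix_eqI[of _ n R])
        (simp_all add: matrix_carriers matrix_mult_diagonal matrix_entry_closed[OF A])
    show "A \<otimes>\<^bsub>matrix_ring n R\<^esub> \<one>\<^bsub>matrix_ring n R\<^esub> = A"
      unfolding one_eq_diagonal using A
      by (intro matrix_eqI[of _ n R])
        (simp_all add: matrix_carriers matrix_mult_diagonal matrix_entry_closed[OF A])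
  qed (simp_all add: matrix_carriers matrix_mult_assoc)
next
  fix A B D
  assume A: "A \<in> carrier (matrix_ring n R)" "B \<in> carrier (matrix_ring n R)"
    "D \<in> carrier (matrix_ring n R)"
  note cl = matrix_entry_closed[OF A(1)] matrix_entry_closed[OF A(2)] matrix_entry_closed[OF A(3)]
  show "(A \<oplus>\<^bsub>matrix_ring n R\<^esub> B) \<otimes>\<^bsub>matrix_ring n R\<^esub> D
      = A \<otimes>\<^bsub>matrix_ring n R\<^esub> D \<oplus>\<^bsub>matrix_ring n R\<^esub> B \<otimes>\<^bsub>matrix_ring n R\<^esub> D"
  proof (rule matrix_eqI[of _ n R])
    fix i j assume ij: "i \<in> {1..n}" "j \<in> {1..n}"
    have "(\<Oplus>k \<in> {1..n}. (A \<oplus>\<^bsub>matrix_ring n R\<^esub> B) (i, k) \<otimes> D (k, j))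
        = (\<Oplus>k \<in> {1..n}. A (i, k) \<otimes> D (k, j) \<oplus> B (i, k) \<otimes> D (k, j))"
      using cl ij by (intro finsum_cong') (auto simp: matrix_ring_entry l_distr)
    then show "((A \<oplus>\<^bsub>matrix_ring n R\<^esub> B) \<otimes>\<^bsub>matrix_ring n R\<^esub> D) (i, j)
        = (A \<otimes>\<^bsub>matrix_ring n R\<^esub> D \<oplus>\<^bsub>matrix_ring n R\<^esub> B \<otimes>\<^bsub>matrix_ring n R\<^esub> D) (i, j)"
      using cl ij by (simp add: matrix_ring_entry(1,2) finsum_addf Pi_def)
  qed (use A in \<open>simp_all add: matrix_carriers\<close>)
  show "D \<otimes>\<^bsub>matrix_ring n R\<^esub> (A \<oplus>\<^bsub>matrix_ring n R\<^esub> B)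
      = D \<otimes>\<^bsub>matrix_ring n R\<^esub> A \<oplus>\<^bsub>matrix_ring n R\<^esub> D \<otimes>\<^bsub>matrix_ring n R\<^esub> B"
  proof (rule matrix_eqI[of _ n R])
    fix i j assume ij: "i \<in> {1..n}" "j \<in> {1..n}"
    have "(\<Oplus>k \<in> {1..n}. D (i, k) \<otimes> (A \<oplus>\<^bsub>matrix_ring n R\<^esub> B) (k, j))
        = (\<Oplus>k \<in> {1..n}. D (i, k) \<otimes> A (k, j) \<oplus> D (i, k) \<otimes> B (k, j))"
      using cl ij by (intro finsum_cong') (auto simp: matrix_ring_entry r_distr)
    then show "(D \<otimes>\<^bsub>matrix_ring n R\<^esub> (A \<oplus>\<^bsub>matrix_ring n R\<^esub> B)) (i, j)
        = (D \<otimes>\<^bsub>matrix_ring n R\<^esub> A \<oplus>\<^bsub>matrix_ring n R\<^esub> D \<otimes>\<^bsub>matrix_ring n R\<^esub> B) (i, j)"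
      using cl ij by (simp add: matrix_ring_entry(1,2) finsum_addf Pi_def)
  qed (use A in \<open>simp_all add: matrix_carriers\<close>)
qed

lemma matrix_mult_entry:
  assumes A: "A \<in> carrier (matrix_ring n R)" and r: "r \<in> carrier R"
    and i: "i \<in> {1..n}" and j: "j \<in> {1..n}" and ab: "a \<in> {1..n}" "b \<in> {1..n}"
  shows "(entry_matrix n R i j r \<otimes>\<^bsub>matrix_ring n R\<^esub> A) (a, b) =
      (if a = i then r \<otimes> A (j, b) else \<zero>)"
    and "(A \<otimes>\<^bsub>matrix_ring n R\<^esub> entry_matrix n R i j r) (a, b) =
      (if b = j then A (a, i) \<otimes> r else \<zero>)"
proof -
  note cl = matrix_entry_closed[OF A]
  show "(entry_matrix n R i j r \<otimes>\<^bsub>matrix_ring n R\<^esub> A) (a, b) =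
      (if a = i then r \<otimes> A (j, b) else \<zero>)"
    unfolding matrix_ring_entry(1)[OF ab] using cl r i j ab
    by (intro finsum_only[of _ j]) (auto simp: matrix_ring_entry)
  show "(A \<otimes>\<^bsub>matrix_ring n R\<^esub> entry_matrix n R i j r) (a, b) =
      (if b = j then A (a, i) \<otimes> r else \<zero>)"
    unfolding matrix_ring_entry(1)[OF ab] using cl r i j ab
    by (intro finsum_only[of _ i]) (auto simp: matrix_ring_entry)
qed

lemma entry_matrix_mult:
  assumes "r \<in> carrier R" "s \<in> carrier R" "i \<in> {1..n}" "j \<in> {1..n}" "k \<in> {1..n}"
  shows "entry_matrix n R i j r \<otimes>\<^bsub>matrix_ring n R\<^esub> entry_matrix n R j k s =
    entry_matrix n R i k (r \<otimes> s)"
  using assms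
  by (intro matrix_eqI[of _ n R])
    (auto simp: matrix_carriers matrix_mult_entry(1) matrix_ring_entry(5))

lemma entry_matrix_sandwich:
  assumes A: "A \<in> carrier (matrix_ring n R)" and rs: "r \<in> carrier R" "s \<in> carrier R"
    and ix: "i \<in> {1..n}" "j \<in> {1..n}" "k \<in> {1..n}" "l \<in> {1..n}"
  shows "entry_matrix n R i k r \<otimes>\<^bsub>matrix_ring n R\<^esub> (A \<otimes>\<^bsub>matrix_ring n R\<^esub> entry_matrix n R l j s) =
    entry_matrix n R i j (r \<otimes> (A (k, l) \<otimes> s))"
  using assms matrix_entry_closed[OF A]
  by (intro matrix_eqI[of _ n R])
    (auto simp: matrix_carriers matrix_mult_entry matrix_ring_entry(5))

lemma entry_matrix_add:
  assumes "r \<in> carrier R" "s \<in> carrier R"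
  shows "entry_matrix n R i j (r \<oplus> s) =
    entry_matrix n R i j r \<oplus>\<^bsub>matrix_ring n R\<^esub> entry_matrix n R i j s"
  using assms
  by (intro matrix_eqI[of _ n R]) (auto simp: matrix_carriers matrix_ring_entry(2,5))

lemma entry_matrix_zero: "entry_matrix n R i j \<zero> = \<zero>\<^bsub>matrix_ring n R\<^esub>"
  by (intro matrix_eqI[of _ n R]) (auto simp: matrix_carriers matrix_ring_entry(3,5))

lemma entry_matrix_minus:
  assumes "r \<in> carrier R" "s \<in> carrier R"
  shows "entry_matrix n R i j (r \<ominus> s) =
    entry_matrix n R i j r \<ominus>\<^bsub>matrix_ring n R\<^esub> entry_matrix n R i j s"
proof -
  interpret M: ring "matrix_ring n R"
    by (rule ring_matrix_ring)
  have "entry_matrix n R i j (\<ominus> s) \<oplus>\<^bsub>matrix_ring n R\<^esub> entry_matrix n R i j s = \<zero>\<^bsub>matrix_ring n R\<^esub>"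
    using assms entry_matrix_add[of "\<ominus> s" s n i j] entry_matrix_zero by (simp add: l_neg)
  then have "entry_matrix n R i j (\<ominus> s) = \<ominus>\<^bsub>matrix_ring n R\<^esub> entry_matrix n R i j s"
    using M.minus_equality assms matrix_carriers(5) by (metis a_inv_closed)
  then show ?thesis
    using assms by (simp add: minus_eq M.minus_eq entry_matrix_add)
qed

lemma finsum_matrix_entry:
  assumes "\<And>k. k \<in> K \<Longrightarrow> g k \<in> carrier (matrix_ring n R)" and ij: "i \<in> {1..n}" "j \<in> {1..n}"
    and "finite K"
  shows "(finsum (matrix_ring n R) g K) (i, j) = (\<Oplus>k \<in> K. g k (i, j))"
proof -
  interpret M: ring "matrix_ring n R"
    by (rule ring_matrix_ring)
  show ?thesis
    using assms(4,1)
  proof (induction K)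
    case (insert k K)
    then have "g l (i, j) \<in> carrier R" if "l \<in> insert k K" for l
      using matrix_entry_closed[of "g l" n R i j] ij that by blast
    with insert show ?case
      using ij by (subst M.finsum_insert) (auto simp: matrix_ring_entry)
  qed (use ij in \<open>simp add: matrix_ring_entry\<close>)
qed

lemma one_eq_sum_entry_matrices:
  "\<one>\<^bsub>matrix_ring n R\<^esub> = finsum (matrix_ring n R) (\<lambda>k. entry_matrix n R k k \<one>) {1..n}"
proof -
  interpret M: ring "matrix_ring n R"
    by (rule ring_matrix_ring)
  show ?thesis
  proof (rule matrix_eqI[of _ n R])
    fix i j assume ij: "i \<in> {1..n}" "j \<in> {1..n}"
    have "(\<Oplus>k \<in> {1..n}. entry_matrix n R k k \<one> (i, j)) = (if i = j then \<one> else \<zero>)"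
      using ij by (intro finsum_only[of _ i]) (auto simp: matrix_ring_entry)
    then show "\<one>\<^bsub>matrix_ring n R\<^esub> (i, j)
        = (finsum (matrix_ring n R) (\<lambda>k. entry_matrix n R k k \<one>) {1..n}) (i, j)"
      using ij by (simp add: finsum_matrix_entry matrix_carriers matrix_ring_entry(4))
  qed (auto intro!: M.finsum_closed simp: matrix_carriers)
qed

text \<open>
  With \<open>A = \<one>\<close> this says that a matrix lies in a left ideal if all its rows, taken separately, do.
\<close>

lemma matrix_left_ideal_by_units:
  assumes J: "left_ideal J (matrix_ring n R)"
    and A: "A \<in> carrier (matrix_ring n R)" and B: "B \<in> carrier (matrix_ring n R)"
    and mem: "\<And>k. k \<in> {1..n} \<Longrightarrow>
      A \<otimes>\<^bsub>matrix_ring n R\<^esub> (entry_matrix n R k k \<one> \<otimes>\<^bsub>matrix_ring n R\<^esub> B) \<in> J"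
  shows "A \<otimes>\<^bsub>matrix_ring n R\<^esub> B \<in> J"
proof -
  interpret M: ring "matrix_ring n R"
    by (rule ring_matrix_ring)
  have car: "\<And>k. entry_matrix n R k k \<one> \<in> carrier (matrix_ring n R)"
    by (simp add: matrix_carriers)
  have "A \<otimes>\<^bsub>matrix_ring n R\<^esub> B = A \<otimes>\<^bsub>matrix_ring n R\<^esub>
      (finsum (matrix_ring n R) (\<lambda>k. entry_matrix n R k k \<one>) {1..n} \<otimes>\<^bsub>matrix_ring n R\<^esub> B)"
    using A B unfolding one_eq_sum_entry_matrices[symmetric] by simp
  also have "\<dots> = finsum (matrix_ring n R)
      (\<lambda>k. A \<otimes>\<^bsub>matrix_ring n R\<^esub> (entry_matrix n R k k \<one> \<otimes>\<^bsub>matrix_ring n R\<^esub> B)) {1..n}"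
    using A B car by (simp add: M.finsum_ldistr M.finsum_rdistr Pi_def)
  also have "\<dots> \<in> J"
    by (rule M.left_ideal_finsum[OF J mem])
  finally show ?thesis .
qed

text \<open>
  Write \<open>E i j r\<close> for the matrix with single entry \<open>r\<close>, and let \<open>J\<close> be a maximal left ideal of the
  matrix ring. Some diagonal unit \<open>E p p \<one>\<close> lies outside \<open>J\<close>, and this unit generates the simple
  module \<open>W\<close> of matrices modulo \<open>J\<close>. By Morita equivalence \<open>E p p \<one>\<close> cuts out of \<open>W\<close> a simple
  \<open>R\<close>-module, which is \<open>R / L\<close> for the left ideal \<open>L\<close> of all \<open>r\<close> with \<open>E p p r \<in> J\<close>, and \<open>W\<close> is
  a sum of \<open>n\<close> copies of it, the \<open>i\<close>-th consisting of the classes of \<open>E i p r\<close>. Hence the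
  matrices \<open>E i p u\<close>, where \<open>u\<close> runs through testing elements for \<open>L\<close>, test \<open>J\<close>.
\<close>

lemma finitely_tested_matrix_ring:
  assumes tested: "\<And>L. maximal_left_ideal L R \<Longrightarrow> finitely_tested L R"
    and J: "maximal_left_ideal J (matrix_ring n R)"
  shows "finitely_tested J (matrix_ring n R)"
proof -
  interpret M: ring "matrix_ring n R"
    by (rule ring_matrix_ring)
  let ?E = "entry_matrix n R"
  note J' = M.maximal_left_ideal_D(1)[OF J]
  note Jcl = M.left_ideal_closed[OF J']
  obtain p where p: "p \<in> {1..n}" "?E p p \<one> \<notin> J"
    using M.left_ideal_finsum[OF J', of "{1..n}" "\<lambda>k. ?E k k \<one>"] M.maximal_left_ideal_D(2)[OF J]
    unfolding one_eq_sum_entry_matrices by blast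
  define L where "L = {r \<in> carrier R. ?E p p r \<in> J}"
  have L_left: "left_ideal L R"
    unfolding left_ideal_def
  proof (intro conjI ballI)
    show "\<zero> \<in> L"
      unfolding L_def using Jcl(2) by (simp add: entry_matrix_zero)
    show "x \<oplus> y \<in> L" if "x \<in> L" "y \<in> L" for x y
      using that Jcl(3) unfolding L_def by (simp add: entry_matrix_add)
    show "a \<otimes> x \<in> L" if "a \<in> carrier R" "x \<in> L" for a x
    proof -
      have "?E p p a \<otimes>\<^bsub>matrix_ring n R\<^esub> ?E p p x \<in> J"
        using that Jcl(4) unfolding L_def by (simp add: matrix_carriers)
      then show ?thesis
        using that p unfolding L_def by (simp add: entry_matrix_mult)
    qed
  qed (auto simp: L_def)
  have L_max: "maximal_left_ideal L R"
  proof (rule maximal_left_idealI[OF L_left])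
    show "\<one> \<notin> L"
      using p unfolding L_def by simp
    fix x assume x: "x \<in> carrier R" "x \<notin> L"
    then have "?E p p x \<notin> J" "?E p p x \<in> carrier (matrix_ring n R)"
      unfolding L_def by (simp_all add: matrix_carriers)
    then obtain Z where Z: "Z \<in> carrier (matrix_ring n R)"
      "?E p p \<one> \<ominus>\<^bsub>matrix_ring n R\<^esub> Z \<otimes>\<^bsub>matrix_ring n R\<^esub> ?E p p x \<in> J"
      using M.maximal_left_ideal_generate[OF J, of "?E p p x" "?E p p \<one>"] by (auto simp: matrix_carriers)
    have Zpp: "Z (p, p) \<in> carrier R"
      using matrix_entry_closed[OF Z(1)] p by blast
    have "?E p p \<one> \<otimes>\<^bsub>matrix_ring n R\<^esub>
        (?E p p \<one> \<ominus>\<^bsub>matrix_ring n R\<^esub> Z \<otimes>\<^bsub>matrix_ring n R\<^esub> ?E p p x)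
      = ?E p p (\<one> \<ominus> Z (p, p) \<otimes> x)"
      using Z(1) x(1) p Zpp
      by (simp add: M.minus_eq M.r_distr M.r_minus matrix_carriers entry_matrix_mult
          entry_matrix_sandwich) (simp add: M.minus_eq[symmetric] entry_matrix_minus)
    then have "\<one> \<ominus> Z (p, p) \<otimes> x \<in> L"
      using Jcl(4)[OF _ Z(2), of "?E p p \<one>"] x(1) Zpp unfolding L_def by (simp add: matrix_carriers)
    then show "\<exists>a \<in> carrier R. \<one> \<ominus> a \<otimes> x \<in> L"
      using Zpp by blast
  qed
  obtain U where U: "finite U" "U \<subseteq> carrier R" "\<forall>r \<in> carrier R. (\<forall>u \<in> U. r \<otimes> u \<in> L) \<longrightarrow>
      (\<forall>x \<in> carrier R. r \<otimes> x \<in> L)"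
    using tested[OF L_max] unfolding finitely_tested_def by auto
  define V where "V = (\<lambda>(i, u). ?E i p u) ` ({1..n} \<times> U)"
  have V: "finite V" "V \<subseteq> carrier (matrix_ring n R)"
    unfolding V_def using U by (auto simp: matrix_carriers)
  have V_tests: "Z \<otimes>\<^bsub>matrix_ring n R\<^esub> W \<in> J"
    if Z: "Z \<in> carrier (matrix_ring n R)" "\<forall>v \<in> V. Z \<otimes>\<^bsub>matrix_ring n R\<^esub> v \<in> J"
      and W: "W \<in> carrier (matrix_ring n R)" for Z W
  proof -
    note Zcl = matrix_entry_closed[OF Z(1)]
    have "Z (k, i) \<otimes> u \<in> L" if "k \<in> {1..n}" "i \<in> {1..n}" "u \<in> U" for k i u
    proof -
      have u: "u \<in> carrier R"
        using that U(2) by blast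
      have "Z \<otimes>\<^bsub>matrix_ring n R\<^esub> ?E i p u \<in> J"
        using Z(2) that unfolding V_def by auto
      then have "?E p k \<one> \<otimes>\<^bsub>matrix_ring n R\<^esub> (Z \<otimes>\<^bsub>matrix_ring n R\<^esub> ?E i p u) \<in> J"
        using Jcl(4) by (simp add: matrix_carriers)
      then show ?thesis
        using that u p Z(1) Zcl unfolding L_def by (simp add: entry_matrix_sandwich)
    qed
    then have ZL: "Z (k, i) \<otimes> r \<in> L" if "k \<in> {1..n}" "i \<in> {1..n}" "r \<in> carrier R" for k i r
      using U(3) Zcl that by blast
    \<comment> \<open>The columns \<open>E i p r\<close> span the matrices modulo \<open>J\<close>, so it suffices to treat these, row by row.\<close>
    have ZE: "Z \<otimes>\<^bsub>matrix_ring n R\<^esub> ?E i p r \<in> J" if i: "i \<in> {1..n}" and r: "r \<in> carrier R" for i r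
    proof -
      have rows: "?E k k \<one> \<otimes>\<^bsub>matrix_ring n R\<^esub> (Z \<otimes>\<^bsub>matrix_ring n R\<^esub> ?E i p r) \<in> J"
        if k: "k \<in> {1..n}" for k
      proof -
        have "?E k p \<one> \<otimes>\<^bsub>matrix_ring n R\<^esub> ?E p p (Z (k, i) \<otimes> r) \<in> J"
          using ZL[OF k i r] Jcl(4) unfolding L_def by (simp add: matrix_carriers)
        then show ?thesis
          using k i r p Z(1) Zcl by (simp add: entry_matrix_sandwich entry_matrix_mult)
      qed
      have "Z \<otimes>\<^bsub>matrix_ring n R\<^esub> ?E i p r \<in> carrier (matrix_ring n R)"
        using Z(1) r by (simp add: matrix_carriers)
      then show ?thesis
        using matrix_left_ideal_by_units[OF J' M.one_closed, of "Z \<otimes>\<^bsub>matrix_ring n R\<^esub> ?E i p r"] rows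
        by (simp add: matrix_carriers)
    qed
    obtain X where X: "X \<in> carrier (matrix_ring n R)"
      "W \<ominus>\<^bsub>matrix_ring n R\<^esub> X \<otimes>\<^bsub>matrix_ring n R\<^esub> ?E p p \<one> \<in> J"
      using M.maximal_left_ideal_generate[OF J _ p(2) W] by (auto simp: matrix_carriers)
    have XE: "X \<otimes>\<^bsub>matrix_ring n R\<^esub> ?E p p \<one> \<in> carrier (matrix_ring n R)"
      using X(1) by (simp add: matrix_carriers)
    have ZXE: "Z \<otimes>\<^bsub>matrix_ring n R\<^esub> (X \<otimes>\<^bsub>matrix_ring n R\<^esub> ?E p p \<one>) \<in> J"
    proof (rule matrix_left_ideal_by_units[OF J' Z(1) XE])
      fix k assume k: "k \<in> {1..n}"
      then show "Z \<otimes>\<^bsub>matrix_ring n R\<^esub> (?E k k \<one> \<otimes>\<^bsub>matrix_ring n R\<^esub>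
          (X \<otimes>\<^bsub>matrix_ring n R\<^esub> ?E p p \<one>)) \<in> J"
        using ZE[OF k] matrix_entry_closed[OF X(1)] X(1) p by (simp add: entry_matrix_sandwich)
    qed
    have "Z \<otimes>\<^bsub>matrix_ring n R\<^esub> W \<ominus>\<^bsub>matrix_ring n R\<^esub>
        Z \<otimes>\<^bsub>matrix_ring n R\<^esub> (X \<otimes>\<^bsub>matrix_ring n R\<^esub> ?E p p \<one>) \<in> J"
      using Jcl(4)[OF Z(1) X(2)] Z(1) W XE by (simp add: M.minus_eq M.r_distr M.r_minus)
    then show ?thesis
      by (rule M.left_ideal_diff_cancel[OF J' _ ZXE M.m_closed[OF Z(1) W]])
  qed
  show ?thesis
    unfolding finitely_tested_def
  proof (intro exI[of _ V] conjI ballI impI)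
    fix Z W
    assume "Z \<in> carrier (matrix_ring n R)" "\<forall>v \<in> V. Z \<otimes>\<^bsub>matrix_ring n R\<^esub> v \<in> J"
      "W \<in> carrier (matrix_ring n R)"
    then show "Z \<otimes>\<^bsub>matrix_ring n R\<^esub> W \<in> J"
      by (rule V_tests)
  qed (rule V)+
qed

end

section \<open>Inverses of structural matrices\<close>

context ring
begin

text \<open>
  For fixed \<open>j\<close> let \<open>D\<close> be the projection to the coordinates \<open>k\<close> with \<open>(k, j) \<in> \<theta>\<close>. Transitivity of
  \<open>\<theta>\<close> says that matrices supported in \<open>\<theta>\<close> preserve the image of \<open>D\<close>. Conversely, if a matrix
  preserves this image, then its \<open>j\<close>-th column is supported in \<open>{k. (k, j) \<in> \<theta>}\<close>, because \<open>j\<close> itself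
  is one of these coordinates by reflexivity. So the claim is that the inverse preserves every
  subspace of this kind that \<open>A\<close> preserves.
\<close>

lemma inverse_in_structural_matrix_ring:
  assumes \<theta>: "refl_on {1..n} \<theta>" "trans \<theta>"
    and tested: "\<And>L. maximal_left_ideal L R \<Longrightarrow> finitely_tested L R"
    and A: "A \<in> carrier (structural_matrix_ring n \<theta> R)" "A \<in> Units (matrix_ring n R)"
  shows "inv\<^bsub>matrix_ring n R\<^esub> A \<in> carrier (structural_matrix_ring n \<theta> R)"
proof -
  interpret M: ring "matrix_ring n R"
    by (rule ring_matrix_ring)
  define B where "B = inv\<^bsub>matrix_ring n R\<^esub> A"
  have B: "B \<in> carrier (matrix_ring n R)"
    unfolding B_def using A(2) by (rule M.Units_inv_closed)
  have Acar: "A \<in> carrier (matrix_ring n R)"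
    using A(2) unfolding Units_def by simp
  have A0: "A (i, k) = \<zero>" if "i \<in> {1..n}" "k \<in> {1..n}" "(i, k) \<notin> \<theta>" for i k
    using A(1) that unfolding structural_matrix_ring_def by simp
  have "B (i, j) = \<zero>" if ij: "i \<in> {1..n}" "j \<in> {1..n}" "(i, j) \<notin> \<theta>" for i j
  proof -
    define d where "d k = (if (k, j) \<in> \<theta> then \<one> else \<zero>)" for k
    define D where "D = diagonal_matrix n R d"
    have d: "d k \<in> carrier R" for k
      unfolding d_def by simp
    have D: "D \<in> carrier (matrix_ring n R)"
      unfolding D_def using d by (simp add: matrix_carriers)
    have DD: "D \<otimes>\<^bsub>matrix_ring n R\<^esub> D = D"
      using D d unfolding D_def
      by (intro matrix_eqI[of _ n R])
        (auto simp: matrix_carriers matrix_mult_diagonal matrix_ring_entry(6) d_def)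
    have DAD: "D \<otimes>\<^bsub>matrix_ring n R\<^esub> (A \<otimes>\<^bsub>matrix_ring n R\<^esub> D) = A \<otimes>\<^bsub>matrix_ring n R\<^esub> D"
    proof (rule matrix_eqI[of _ n R])
      fix a b assume ab: "a \<in> {1..n}" "b \<in> {1..n}"
      have "A (a, b) = \<zero>" if "(b, j) \<in> \<theta>" "(a, j) \<notin> \<theta>"
        using A0[OF ab] that \<theta>(2) by (meson transD)
      then have "d a \<otimes> (A (a, b) \<otimes> d b) = A (a, b) \<otimes> d b"
        using matrix_entry_closed[OF Acar ab] unfolding d_def by auto
      then show "(D \<otimes>\<^bsub>matrix_ring n R\<^esub> (A \<otimes>\<^bsub>matrix_ring n R\<^esub> D)) (a, b)
          = (A \<otimes>\<^bsub>matrix_ring n R\<^esub> D) (a, b)"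
        using ab Acar D d unfolding D_def by (simp add: matrix_mult_diagonal matrix_carriers)
    qed (use D Acar in \<open>simp_all add: matrix_carriers\<close>)
    have "D \<otimes>\<^bsub>matrix_ring n R\<^esub> (B \<otimes>\<^bsub>matrix_ring n R\<^esub> D) = B \<otimes>\<^bsub>matrix_ring n R\<^esub> D"
      unfolding B_def by (rule M.inverse_preserves_corner[OF
            M.left_inverse_imp_right_inverse[OF finitely_tested_matrix_ring[OF tested]] D DD A(2) DAD])
    then have "(D \<otimes>\<^bsub>matrix_ring n R\<^esub> (B \<otimes>\<^bsub>matrix_ring n R\<^esub> D)) (i, j) =
        (B \<otimes>\<^bsub>matrix_ring n R\<^esub> D) (i, j)"
      by simp
    then have "d i \<otimes> (B (i, j) \<otimes> d j) = B (i, j) \<otimes> d j"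
      using ij(1,2) B D d unfolding D_def by (simp add: matrix_mult_diagonal matrix_carriers)
    moreover have "(j, j) \<in> \<theta>"
      using \<theta>(1) ij(2) by (auto dest: refl_onD)
    ultimately show ?thesis
      using matrix_entry_closed[OF B ij(1,2)] ij(3) unfolding d_def by simp
  qed
  with B show ?thesis
    unfolding B_def[symmetric] structural_matrix_ring_def by simp
qed

end

theorem theorem3p4:
  fixes R :: "('a, 'b) ring_scheme" and C :: "'a set"
    and n :: nat and \<theta> :: "(nat \<times> nat) set" and A :: "nat \<times> nat \<Rightarrow> 'a"
  assumes "n \<ge> 1"
    and "\<theta> \<subseteq> {1..n} \<times> {1..n}" and "refl_on {1..n} \<theta>" and "trans \<theta>"
    and "ring R"
    and "subring C R" and "C \<subseteq> ring_center R"
    and "noetherian_ring (R\<lparr>carrier := C\<rparr>)"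
    and "PI_algebra R C"
    and "A \<in> carrier (structural_matrix_ring n \<theta> R)"
    and "A \<in> Units (matrix_ring n R)"
  shows "inv\<^bsub>matrix_ring n R\<^esub> A \<in> carrier (structural_matrix_ring n \<theta> R)"
proof -
  interpret ring R
    by (rule assms(5))
  show ?thesis
    using inverse_in_structural_matrix_ring[OF assms(3,4) PI_finitely_tested[OF assms(9,7)] assms(10,11)] .
qed

end
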